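(* A Lawvere metric space is Isbell convex if and only if it is complete (as a category enriched over the Lawvere quantale $([0,\infty],\geq,0,+)$).
   Context: The Lawvere quantale is $\overline{\mathbb{R}}^{\geq 0}_+=([0,\infty],\geq,0,+)$: the underlying poset is $[0,\infty]$ with the opposite $\geq$ of the usual order (so $\infty$ is the least element and suprema in the quantale are usual infima), and the monoid structure is addition with $x+\infty=\infty+x=\infty$. Its residuation $y\searrow z=z\swarrow y$ is: $\max\{z-y,0\}$ if $y,z<\infty$; $0$ if $y=\infty$; $\infty$ if $z=\infty$ and $y<\infty$. A Lawvere metric space is a category enriched over this quantale, i.e. a set $\mathrm{ob}(\mathcal{C})$ (one writes $c\in\mathcal{C}$) with $\mathcal{C}(c,c')\in[0,\infty]$ for all $c,c'\in\mathcal{C}$ such that $\mathcal{C}(c,c)=0$ and $\mathcal{C}(c',c'')+\mathcal{C}(c,c')\geq\mathcal{C}(c,c'')$ (no symmetry, finiteness, or separation is assumed). Isbell convexity: $\mathcal{C}$ is Isbell convex if for any (possibly infinite) family $((c_i,x_i,y_i))_{i\in I}$ with $c_i\in\mathcal{C}$ and $x_i,y_i\in[0,\infty]$, if $x_i+y_j\geq\mathcal{C}(c_i,c_j)$ for all $i,j\in I$, then there exists $c\in\mathcal{C}$ such that $x_i\geq\mathcal{C}(c_i,c)$ and $y_i\geq\mathcal{C}(c,c_i)$ for all $i\in I$. Completeness: put $c\preceq_{\mathcal{C}}c'\iff\mathcal{C}(c,c')=0$, a preorder on $\mathrm{ob}(\mathcal{C})$. A power of $c\in\mathcal{C}$ by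 $x\in[0,\infty]$ is an object $c'\in\mathcal{C}$ with $\mathcal{C}(d,c')=x\searrow\mathcal{C}(d,c)$ for all $d\in\mathcal{C}$; a copower of $c$ by $x$ is an object $c'\in\mathcal{C}$ with $\mathcal{C}(c',d)=\mathcal{C}(c,d)\swarrow x$ for all $d\in\mathcal{C}$. $\mathcal{C}$ is complete if all powers and all copowers (for all $c\in\mathcal{C}$, $x\in[0,\infty]$) exist in $\mathcal{C}$ and $\mathcal{C}$ is order-complete, i.e. the poset reflection (quotient by the equivalence relation $c\preceq_{\mathcal{C}}c'\preceq_{\mathcal{C}}c$) of $(\mathrm{ob}(\mathcal{C}),\preceq_{\mathcal{C}})$ is a complete lattice. *)

theory Defs
  imports "HOL-Library.Extended_Nonnegative_Real" "HOL-Algebra.Complete_Lattice"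
begin

text \<open>
  The carrier of the Lawvere quantale is \<^typ>\<open>ennreal\<close>. Throughout, \<open>\<le>\<close> is the usual order on
  \<open>[0,\<infinity>]\<close>, i.e. the opposite of the order of the quantale.
\<close>

locale lawvere_metric_space =
  fixes ob :: "'a set" and C :: "'a \<Rightarrow> 'a \<Rightarrow> ennreal"
  assumes identity: "c \<in> ob \<Longrightarrow> C c c = 0"
    and composition:
      "c \<in> ob \<Longrightarrow> c' \<in> ob \<Longrightarrow> c'' \<in> ob \<Longrightarrow> C c' c'' + C c c' \<ge> C c c''"

text \<open>
  The quantale is commutative, so the left and right residuations coincide. In the last case the
  subtraction of \<^typ>\<open>ennreal\<close> is truncated at \<open>0\<close>, so it is \<open>max {z - y, 0}\<close>.
\<close>

definition residual :: "ennreal \<Rightarrow> ennreal \<Rightarrow> ennreal" where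
  "residual y z = (if y = \<infinity> then 0 else if z = \<infinity> then \<infinity> else z - y)"

lemma residual_le_iff: "residual y z \<le> x \<longleftrightarrow> z \<le> x + y"
proof (cases "y = \<infinity> \<or> z = \<infinity>")
  case True
  then show ?thesis
    by (auto simp: residual_def top_unique less_top[symmetric])
next
  case False
  then show ?thesis
    by (simp add: residual_def ennreal_minus_le_iff add.commute)
qed

text \<open>
  A family of triples enters the condition only through its set of values, so we quantify over
  sets \<open>T\<close> of triples; \<open>isbell_convex_family\<close> below recovers families over any index type.
\<close>

definition isbell_convex :: "'a set \<Rightarrow> ('a \<Rightarrow> 'a \<Rightarrow> ennreal) \<Rightarrow> bool" where
  "isbell_convex ob C \<longleftrightarrow>
    (\<forall>T \<subseteq> ob \<times> (UNIV :: ennreal set) \<times> (UNIV :: ennreal set).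
      (\<forall>(c, x, y) \<in> T. \<forall>(c', x', y') \<in> T. x + y' \<ge> C c c') \<longrightarrow>
      (\<exists>c \<in> ob. \<forall>(c', x', y') \<in> T. x' \<ge> C c' c \<and> y' \<ge> C c c'))"

lemma isbell_convex_family:
  fixes I :: "'i set" and c :: "'i \<Rightarrow> 'a" and x y :: "'i \<Rightarrow> ennreal"
  assumes "isbell_convex ob C"
    and "\<And>i. i \<in> I \<Longrightarrow> c i \<in> ob"
    and "\<And>i j. i \<in> I \<Longrightarrow> j \<in> I \<Longrightarrow> x i + y j \<ge> C (c i) (c j)"
  shows "\<exists>c' \<in> ob. \<forall>i \<in> I. x i \<ge> C (c i) c' \<and> y i \<ge> C c' (c i)"
proof -
  let ?T = "(\<lambda>i. (c i, x i, y i)) ` I"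
  have "?T \<subseteq> ob \<times> UNIV \<times> UNIV"
    using assms(2) by auto
  moreover have "\<forall>(d, u, v) \<in> ?T. \<forall>(d', u', v') \<in> ?T. u + v' \<ge> C d d'"
    using assms(3) by auto
  ultimately have "\<exists>c' \<in> ob. \<forall>(d, u, v) \<in> ?T. u \<ge> C d c' \<and> v \<ge> C c' d"
    using assms(1) unfolding isbell_convex_def by blast
  then show ?thesis
    by auto
qed

definition is_power :: "'a set \<Rightarrow> ('a \<Rightarrow> 'a \<Rightarrow> ennreal) \<Rightarrow> 'a \<Rightarrow> ennreal \<Rightarrow> 'a \<Rightarrow> bool" where
  "is_power ob C c x c' \<longleftrightarrow> c' \<in> ob \<and> (\<forall>d \<in> ob. C d c' = residual x (C d c))"

definition is_copower :: "'a set \<Rightarrow> ('a \<Rightarrow> 'a \<Rightarrow> ennreal) \<Rightarrow> 'a \<Rightarrow> ennreal \<Rightarrow> 'a \<Rightarrow> bool" where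
  "is_copower ob C c x c' \<longleftrightarrow> c' \<in> ob \<and> (\<forall>d \<in> ob. C c' d = residual x (C c d))"

definition underlying_le :: "('a \<Rightarrow> 'a \<Rightarrow> ennreal) \<Rightarrow> 'a \<Rightarrow> 'a \<Rightarrow> bool" where
  "underlying_le C c c' \<longleftrightarrow> C c c' = 0"

definition underlying_equiv :: "'a set \<Rightarrow> ('a \<Rightarrow> 'a \<Rightarrow> ennreal) \<Rightarrow> 'a rel" where
  "underlying_equiv ob C =
    {(c, c'). c \<in> ob \<and> c' \<in> ob \<and> underlying_le C c c' \<and> underlying_le C c' c}"

definition poset_reflection :: "'a set \<Rightarrow> ('a \<Rightarrow> 'a \<Rightarrow> ennreal) \<Rightarrow> 'a set gorder" where
  "poset_reflection ob C =
    \<lparr>carrier = ob // underlying_equiv ob C,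
     eq = (=),
     le = (\<lambda>A B. \<exists>a \<in> A. \<exists>b \<in> B. underlying_le C a b)\<rparr>"

definition order_complete :: "'a set \<Rightarrow> ('a \<Rightarrow> 'a \<Rightarrow> ennreal) \<Rightarrow> bool" where
  "order_complete ob C \<longleftrightarrow> complete_lattice (poset_reflection ob C)"

definition lawvere_complete :: "'a set \<Rightarrow> ('a \<Rightarrow> 'a \<Rightarrow> ennreal) \<Rightarrow> bool" where
  "lawvere_complete ob C \<longleftrightarrow>
    (\<forall>c \<in> ob. \<forall>x. \<exists>c'. is_power ob C c x c') \<and>
    (\<forall>c \<in> ob. \<forall>x. \<exists>c'. is_copower ob C c x c') \<and>
    order_complete ob C"

context lawvere_metric_space
begin

lemma underlying_le_trans:
  assumes "c \<in> ob" "c' \<in> ob" "c'' \<in> ob" "underlying_le C c c'" "underlying_le C c' c''"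
  shows "underlying_le C c c''"
  using composition[of c c' c''] assms by (simp add: underlying_le_def)

lemma equiv_underlying_equiv: "equiv ob (underlying_equiv ob C)"
proof (rule equivI)
  show "underlying_equiv ob C \<subseteq> ob \<times> ob"
    by (auto simp: underlying_equiv_def)
  show "refl_on ob (underlying_equiv ob C)"
    by (auto simp: refl_on_def underlying_equiv_def underlying_le_def identity)
  show "sym (underlying_equiv ob C)"
    by (auto simp: sym_def underlying_equiv_def)
  show "trans (underlying_equiv ob C)"
    unfolding trans_def underlying_equiv_def using underlying_le_trans by blast
qed

lemma le_poset_reflection_iff:
  assumes "c \<in> ob" "c' \<in> ob"
  shows "le (poset_reflection ob C) (underlying_equiv ob C `` {c}) (underlying_equiv ob C `` {c'})
    \<longleftrightarrow> underlying_le C c c'"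
proof
  assume "le (poset_reflection ob C) (underlying_equiv ob C `` {c}) (underlying_equiv ob C `` {c'})"
  then obtain a b where "a \<in> ob" "b \<in> ob" "underlying_le C c a" "underlying_le C a b"
      "underlying_le C b c'"
    by (auto simp: poset_reflection_def underlying_equiv_def)
  then show "underlying_le C c c'"
    using underlying_le_trans assms by blast
next
  assume "underlying_le C c c'"
  then show "le (poset_reflection ob C) (underlying_equiv ob C `` {c}) (underlying_equiv ob C `` {c'})"
    using assms identity by (auto simp: poset_reflection_def underlying_equiv_def underlying_le_def)
qed

end

end

theory Submission
  imports Defs
begin

text \<open>
  Both conditions say that \<open>C\<close> has all weighted limits and colimits. In one direction, Isbell
  convexity applied to a weight together with the upper bounds that it forces on \<open>C d m\<close> yields the
  weighted limit \<open>m\<close>; powers and meets are special cases, and copowers follow because Isbell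
  convexity is self-dual. In the other direction, the point required by a family
  \<open>(c\<^sub>i, x\<^sub>i, y\<^sub>i)\<close> is the meet of the powers of the \<open>c\<^sub>i\<close> by the \<open>y\<^sub>i\<close>: it lies above the copower
  of each \<open>c\<^sub>j\<close> by \<open>x\<^sub>j\<close>, since the latter lies below all of these powers.
\<close>

lemma residual_0_left [simp]: "residual 0 z = z"
  by (simp add: residual_def)

lemma residual_eq_0_iff: "residual y z = 0 \<longleftrightarrow> z \<le> y"
  using residual_le_iff[of y z 0] by simp

text \<open>Swapping the last two components of every triple turns an admissible family for the
  opposite space into one for \<open>C\<close>, with the same solutions. This lets results about
  powers be reused for copowers.\<close>

lemma isbell_convex_dual:
  assumes "isbell_convex ob C"
  shows "isbell_convex ob (\<lambda>c c'. C c' c)"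
  unfolding isbell_convex_def
proof (intro allI impI)
  fix T :: "('a \<times> ennreal \<times> ennreal) set"
  assume T: "T \<subseteq> ob \<times> UNIV \<times> UNIV"
    and le: "\<forall>(c, x, y)\<in>T. \<forall>(c', x', y')\<in>T. C c' c \<le> x + y'"
  have "\<exists>c'\<in>ob. \<forall>t\<in>T. C (fst t) c' \<le> snd (snd t) \<and> C c' (fst t) \<le> fst (snd t)"
  proof (rule isbell_convex_family[OF assms])
    show "fst t \<in> ob" if "t \<in> T" for t
      using T that by auto
    show "C (fst s) (fst t) \<le> snd (snd s) + fst (snd t)" if "s \<in> T" "t \<in> T" for s t
      using le that by (fastforce simp: add.commute)
  qed
  then show "\<exists>c\<in>ob. \<forall>(c', x', y')\<in>T. C c c' \<le> x' \<and> C c' c \<le> y'"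
    by fastforce
qed

context lawvere_metric_space
begin

lemma lawvere_metric_space_dual: "lawvere_metric_space ob (\<lambda>c c'. C c' c)"
  by unfold_locales (simp_all add: identity composition add.commute)

text \<open>By residuation, \<open>u\<close> is the least function with
  \<open>C d e \<le> u d + w\<close> for all \<open>(e, w)\<close> in \<open>W\<close>, which is
  just what convexity demands of the triples \<open>(d, u d, w)\<close>. The point obtained
  satisfies \<open>C d m \<le> u d\<close>, and its bounds \<open>C m e \<le> w\<close> give the
  converse by the triangle inequality.\<close>

lemma isbell_convex_weighted_limit:
  assumes "isbell_convex ob C" and W: "W \<subseteq> ob \<times> UNIV"
  obtains m where "m \<in> ob" "\<And>d. d \<in> ob \<Longrightarrow> C d m = (SUP (e, w)\<in>W. residual w (C d e))"
proof -
  define u where "u d = (SUP (e, w)\<in>W. residual w (C d e))" for d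
  have u_ge: "C d e \<le> u d + w" if "(e, w) \<in> W" for d e w
    using that unfolding residual_le_iff[symmetric] u_def by (force intro: SUP_upper2)
  \<comment> \<open>The value \<open>\<infinity>\<close> in the last component of the family makes the bound on \<open>C m d\<close> void outside \<open>W\<close>.\<close>
  let ?I = "W \<union> ob \<times> {\<infinity>}"
  have "\<exists>m\<in>ob. \<forall>i\<in>?I. C (fst i) m \<le> u (fst i) \<and> C m (fst i) \<le> snd i"
    by (rule isbell_convex_family[OF assms(1)]) (use W in \<open>auto intro: u_ge\<close>)
  then obtain m where m: "m \<in> ob" "\<And>d. d \<in> ob \<Longrightarrow> C d m \<le> u d"
    and m_le: "\<And>e w. (e, w) \<in> W \<Longrightarrow> C m e \<le> w"
    by force
  have "u d \<le> C d m" if "d \<in> ob" for d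
    unfolding u_def
  proof (rule SUP_least, clarify)
    fix e w
    assume ew: "(e, w) \<in> W"
    then have "C d e \<le> C m e + C d m"
      using W m(1) that by (intro composition) auto
    also have "\<dots> \<le> w + C d m"
      using m_le[OF ew] by (rule add_right_mono)
    finally show "residual w (C d e) \<le> C d m"
      by (simp add: residual_le_iff add.commute)
  qed
  with m show thesis
    by (intro that[of m]) (auto simp: u_def intro: antisym)
qed

lemma isbell_convex_power:
  assumes "isbell_convex ob C" "c \<in> ob"
  shows "\<exists>c'. is_power ob C c x c'"
proof -
  from assms(2) have "{(c, x)} \<subseteq> ob \<times> UNIV"
    by simp
  from isbell_convex_weighted_limit[OF assms(1) this] obtain m where
    "m \<in> ob" "\<And>d. d \<in> ob \<Longrightarrow> C d m = (SUP (e, w)\<in>{(c, x)}. residual w (C d e))"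
    by blast
  then show ?thesis
    by (auto simp: is_power_def)
qed

lemma isbell_convex_copower:
  assumes "isbell_convex ob C" "c \<in> ob"
  shows "\<exists>c'. is_copower ob C c x c'"
  \<comment> \<open>A copower in \<open>C\<close> is a power in the opposite space.\<close>
  using lawvere_metric_space.isbell_convex_power[OF lawvere_metric_space_dual
      isbell_convex_dual[OF assms(1)] assms(2)]
  by (simp add: is_power_def is_copower_def)

lemma carrier_poset_reflection:
  "carrier (poset_reflection ob C) = (\<lambda>c. underlying_equiv ob C `` {c}) ` ob"
  by (auto simp: poset_reflection_def quotient_def)

lemma underlying_equiv_class_eqI:
  assumes "c \<in> ob" "c' \<in> ob" "underlying_le C c c'" "underlying_le C c' c"
  shows "underlying_equiv ob C `` {c} = underlying_equiv ob C `` {c'}"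
  using assms by (intro equiv_class_eq[OF equiv_underlying_equiv]) (simp add: underlying_equiv_def)

lemma partial_order_poset_reflection: "partial_order (poset_reflection ob C)"
proof (rule partial_order.intro)
  have eq: "eq (poset_reflection ob C) = (=)"
    by (simp add: poset_reflection_def)
  show "weak_partial_order (poset_reflection ob C)"
  proof unfold_locales
    fix X Y Z
    assume "X \<in> carrier (poset_reflection ob C)" "Y \<in> carrier (poset_reflection ob C)"
    then obtain c c' where c: "c \<in> ob" "X = underlying_equiv ob C `` {c}"
        "c' \<in> ob" "Y = underlying_equiv ob C `` {c'}"
      by (auto simp: carrier_poset_reflection)
    then show "eq (poset_reflection ob C) X Y"
      if "le (poset_reflection ob C) X Y" "le (poset_reflection ob C) Y X"
      using that underlying_equiv_class_eqI[of c c'] by (simp add: eq le_poset_reflection_iff)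
    assume "Z \<in> carrier (poset_reflection ob C)"
    then obtain c'' where "c'' \<in> ob" "Z = underlying_equiv ob C `` {c''}"
      by (auto simp: carrier_poset_reflection)
    with c show "le (poset_reflection ob C) X Z"
      if "le (poset_reflection ob C) X Y" "le (poset_reflection ob C) Y Z"
      using that underlying_le_trans[of c c' c''] by (simp add: le_poset_reflection_iff)
  next
    fix X
    assume "X \<in> carrier (poset_reflection ob C)"
    then show "le (poset_reflection ob C) X X"
      by (auto simp: carrier_poset_reflection le_poset_reflection_iff underlying_le_def identity)
  qed (simp_all add: eq)
  show "partial_order_axioms (poset_reflection ob C)"
    by unfold_locales (simp add: eq)
qed

text \<open>Trades infima of equivalence classes for a condition on representatives: the points
  below \<open>m\<close> are exactly the lower bounds of \<open>S\<close>.\<close>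

lemma greatest_poset_reflection_iff:
  assumes "S \<subseteq> ob" "m \<in> ob"
  shows "greatest (poset_reflection ob C) (underlying_equiv ob C `` {m})
      (Lower (poset_reflection ob C) ((\<lambda>c. underlying_equiv ob C `` {c}) ` S)) \<longleftrightarrow>
    (\<forall>d\<in>ob. (\<forall>s\<in>S. C d s = 0) \<longleftrightarrow> C d m = 0)"
    (is "greatest ?L (?cls m) (Lower ?L (?cls ` S)) \<longleftrightarrow> ?R")
proof -
  have Lower: "?cls d \<in> Lower ?L (?cls ` S) \<longleftrightarrow> (\<forall>s\<in>S. C d s = 0)" if "d \<in> ob" for d
  proof -
    have "?cls d \<in> Lower ?L (?cls ` S) \<longleftrightarrow> (\<forall>s\<in>S. le ?L (?cls d) (?cls s))"
      using that assms(1) unfolding Lower_def carrier_poset_reflection by blast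
    also have "\<dots> \<longleftrightarrow> (\<forall>s\<in>S. C d s = 0)"
      using that assms(1)
      by (intro ball_cong) (auto simp: le_poset_reflection_iff underlying_le_def)
    finally show ?thesis .
  qed
  have "greatest ?L (?cls m) (Lower ?L (?cls ` S)) \<longleftrightarrow>
      ?cls m \<in> Lower ?L (?cls ` S) \<and>
      (\<forall>d\<in>ob. ?cls d \<in> Lower ?L (?cls ` S) \<longrightarrow> le ?L (?cls d) (?cls m))"
  proof -
    have "X \<subseteq> carrier ?L \<and> ?cls m \<in> X \<and> (\<forall>x\<in>X. le ?L x (?cls m)) \<longleftrightarrow>
        ?cls m \<in> X \<and> (\<forall>d\<in>ob. ?cls d \<in> X \<longrightarrow> le ?L (?cls d) (?cls m))"
      if "X \<subseteq> ?cls ` ob" for X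
      using that by (auto simp: carrier_poset_reflection)
    from this[OF Lower_closed[of ?L "?cls ` S", unfolded carrier_poset_reflection]]
    show ?thesis
      by (simp only: greatest_def)
  qed
  also have "\<dots> \<longleftrightarrow> (\<forall>s\<in>S. C m s = 0) \<and> (\<forall>d\<in>ob. (\<forall>s\<in>S. C d s = 0) \<longrightarrow> C d m = 0)"
    using assms(2) by (simp add: Lower le_poset_reflection_iff underlying_le_def)
  also have "\<dots> \<longleftrightarrow> ?R"
  proof -
    \<comment> \<open>Transitivity gives one half of the equivalence in \<open>?R\<close>;
      conversely, \<open>?R\<close> at \<open>d = m\<close> shows that \<open>m\<close> is itself a
      lower bound, since \<open>C m m = 0\<close>.\<close>
    have "\<forall>s\<in>S. C d s = 0" if "\<forall>s\<in>S. C m s = 0" "d \<in> ob" "C d m = 0" for d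
      using assms that underlying_le_trans[of d m] by (auto simp: underlying_le_def)
    then show ?thesis
      using assms(2) identity by meson
  qed
  finally show ?thesis .
qed

text \<open>Infima alone suffice, because a supremum is the infimum of the upper bounds.\<close>

lemma order_complete_iff:
  "order_complete ob C \<longleftrightarrow>
    (\<forall>S\<subseteq>ob. \<exists>m\<in>ob. \<forall>d\<in>ob. (\<forall>s\<in>S. C d s = 0) \<longleftrightarrow> C d m = 0)"
    (is "_ \<longleftrightarrow> ?R")
proof
  let ?L = "poset_reflection ob C" and ?cls = "\<lambda>c. underlying_equiv ob C `` {c}"
  show ?R if "order_complete ob C"
  proof (intro allI impI)
    interpret complete_lattice ?L
      using that by (simp add: order_complete_def)
    fix S
    assume S: "S \<subseteq> ob"
    then obtain i where i: "greatest ?L i (Lower ?L (?cls ` S))"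
      using inf_exists[of "?cls ` S"] by (auto simp: carrier_poset_reflection)
    then have "i \<in> ?cls ` ob"
      unfolding carrier_poset_reflection[symmetric] by (rule greatest_closed)
    then obtain m where m: "m \<in> ob" "i = ?cls m"
      by blast
    with i have "\<forall>d\<in>ob. (\<forall>s\<in>S. C d s = 0) \<longleftrightarrow> C d m = 0"
      by (simp only: greatest_poset_reflection_iff[OF S m(1)])
    with m(1) show "\<exists>m\<in>ob. \<forall>d\<in>ob. (\<forall>s\<in>S. C d s = 0) \<longleftrightarrow> C d m = 0"
      by (rule bexI[rotated])
  qed
  show "order_complete ob C" if R: ?R
  proof -
    interpret partial_order ?L
      by (rule partial_order_poset_reflection)
    have glb: "\<exists>i. greatest ?L i (Lower ?L A)" if "A \<subseteq> carrier ?L" for A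
    proof -
      from that obtain S where S: "S \<subseteq> ob" "A = ?cls ` S"
        unfolding carrier_poset_reflection by (rule subset_imageE)
      obtain m where "m \<in> ob" "\<forall>d\<in>ob. (\<forall>s\<in>S. C d s = 0) \<longleftrightarrow> C d m = 0"
        using R S(1) by meson
      then have "greatest ?L (?cls m) (Lower ?L A)"
        using greatest_poset_reflection_iff[OF S(1)] S(2) by simp
      then show ?thesis ..
    qed
    show ?thesis
      unfolding order_complete_def
    proof (rule complete_lattice_criterion1)
      show "\<exists>g. greatest ?L g (carrier ?L)"
        \<comment> \<open>Every element is a lower bound of the empty set, so its infimum is the top
          element.\<close>
        using glb[of "{}"] by simp
    qed (rule glb)
  qed
qed

text \<open>A meet is a limit with all weights \<open>0\<close>: a supremum of distances vanishes
  iff each of them does.\<close>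

lemma isbell_convex_order_complete:
  assumes "isbell_convex ob C"
  shows "order_complete ob C"
  unfolding order_complete_iff
proof (intro allI impI)
  fix S
  assume "S \<subseteq> ob"
  then have "S \<times> {0} \<subseteq> ob \<times> UNIV"
    by auto
  from isbell_convex_weighted_limit[OF assms this] obtain m
    where "m \<in> ob" and m: "\<And>d. d \<in> ob \<Longrightarrow> C d m = (SUP (e, w)\<in>S \<times> {0}. residual w (C d e))"
    by blast
  have "(\<forall>s\<in>S. C d s = 0) \<longleftrightarrow> C d m = 0" if "d \<in> ob" for d
    using SUP_le_iff[of "\<lambda>(e, w). residual w (C d e)" "S \<times> {0}" 0] m[OF that] by auto
  with \<open>m \<in> ob\<close> show "\<exists>m\<in>ob. \<forall>d\<in>ob. (\<forall>s\<in>S. C d s = 0) \<longleftrightarrow> C d m = 0"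
    by blast
qed

lemma lawvere_complete_isbell_convex:
  assumes "lawvere_complete ob C"
  shows "isbell_convex ob C"
  unfolding isbell_convex_def
proof (intro allI impI)
  fix T :: "('a \<times> ennreal \<times> ennreal) set"
  assume T: "T \<subseteq> ob \<times> UNIV \<times> UNIV"
    and le: "\<forall>(c, x, y)\<in>T. \<forall>(c', x', y')\<in>T. C c c' \<le> x + y'"
  \<comment> \<open>Powers are determined only up to equivalence; collecting all of them avoids a
    choice.\<close>
  let ?S = "{p. \<exists>(c, x, y)\<in>T. is_power ob C c y p}"
  have "?S \<subseteq> ob"
    by (auto simp: is_power_def)
  then obtain m where m: "m \<in> ob" "\<And>d. d \<in> ob \<Longrightarrow> (\<forall>p\<in>?S. C d p = 0) \<longleftrightarrow> C d m = 0"
    using assms unfolding lawvere_complete_def order_complete_iff by meson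
  have "C c m \<le> x \<and> C m c \<le> y" if t: "(c, x, y) \<in> T" for c x y
  proof
    have c: "c \<in> ob"
      using T t by auto
    obtain p where p: "is_power ob C c y p"
      using assms c unfolding lawvere_complete_def by blast
    have "C m p = 0"
      using m(2)[OF m(1)] identity[OF m(1)] t p by blast
    with p m(1) show "C m c \<le> y"
      by (simp add: is_power_def residual_eq_0_iff)
    obtain q where q: "q \<in> ob" "\<And>d. d \<in> ob \<Longrightarrow> C q d = residual x (C c d)"
      using assms c unfolding lawvere_complete_def is_copower_def by meson
    \<comment> \<open>Residuating twice, \<open>C q p' = 0\<close> means
      \<open>C c p' \<le> x\<close>, that is \<open>C c c' \<le> x + y'\<close>, which is the
      hypothesis on the family.\<close>
    have "C q p' = 0" if "(c', x', y') \<in> T" "is_power ob C c' y' p'" for c' x' y' p'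
    proof -
      have "C c c' \<le> x + y'"
        using le t that(1) by fast
      then show ?thesis
        using that(2) c q(2) by (simp add: is_power_def residual_eq_0_iff residual_le_iff)
    qed
    then have "C q m = 0"
      using m(2)[OF q(1)] by blast
    with q(2)[OF m(1)] show "C c m \<le> x"
      by (simp add: residual_eq_0_iff)
  qed
  with m(1) show "\<exists>m\<in>ob. \<forall>(c, x, y)\<in>T. C c m \<le> x \<and> C m c \<le> y"
    by blast
qed

end

theorem proposition7p6:
  fixes ob :: "'a set" and C :: "'a \<Rightarrow> 'a \<Rightarrow> ennreal"
  assumes "lawvere_metric_space ob C"
  shows "isbell_convex ob C \<longleftrightarrow> lawvere_complete ob C"
proof -
  interpret lawvere_metric_space ob C
    by (rule assms)
  show ?thesis
    using isbell_convex_power isbell_convex_copower isbell_convex_order_complete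
      lawvere_complete_isbell_convex
    unfolding lawvere_complete_def by blast
qed

end
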